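(* Let $C=(\varphi,\Phi)$ be a strongly measurable skew-evolution semiflow on $Y=X\times V$ with uniform exponential growth. Then the following statements are equivalent: (i) $C$ is uniformly exponentially stable; (ii) there exist a function $R\in\mathcal{R}$ and a constant $N\geq 1$ such that $$\int_{t}^{\infty}R\left(\Vert \Phi(s,t_{0},x)v\Vert\right)ds\leq N\,R\left(\Vert \Phi(t,t_{0},x)v\Vert\right)$$ for all $(t,t_{0},x,v)\in T\times Y$; (iii) there exist a function $R\in\mathcal{R}$ and a constant $N\geq 1$ such that $$\int_{t_{0}}^{\infty}R\left(\Vert \Phi(s,t_{0},x)v\Vert\right)ds\leq N\,R\left(\Vert v\Vert\right)$$ for all $(t_{0},x,v)\in\mathbb{R}_{+}\times Y$.
   Context: $(X,d)$ is a metric space, $V$ a Banach space, $\mathcal{B}(V)$ the space of bounded linear operators on $V$, $I$ the identity on $V$, $Y=X\times V$, $\mathbb{R}_{+}=[0,\infty)$, $T=\{(t,t_{0})\in\mathbb{R}_{+}^{2}: t\geq t_{0}\}$. Norms on $V$ and $\mathcal{B}(V)$ are denoted $\Vert\cdot\Vert$. $\mathcal{R}$ is the set of nondecreasing functions $R:\mathbb{R}_{+}\to\mathbb{R}_{+}$ with $R(0)=0$ and $R(t)>0$ for all $t>0$. An evolution semiflow on $X$ is a mapping $\varphi:T\times X\to X$ with $\varphi(t,t,x)=x$ for all $(t,x)\in\mathbb{R}_{+}\times X$ and $\varphi(t,s,\varphi(s,t_{0},x))=\varphi(t,t_{0},x)$ for all $(t,s),(s,t_{0})\in T$, $x\in X$.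 An evolution cocycle over $\varphi$ is a mapping $\Phi:T\times X\to\mathcal{B}(V)$ with $\Phi(t,t,x)=I$ for all $t\geq 0$, $x\in X$ and $\Phi(t,s,\varphi(s,t_{0},x))\Phi(s,t_{0},x)=\Phi(t,t_{0},x)$ for all $(t,s),(s,t_{0})\in T$, $x\in X$. The mapping $C:T\times Y\to Y$, $C(t,s,x,v)=(\varphi(t,s,x),\Phi(t,s,x)v)$, is then called a skew-evolution semiflow on $Y$, written $C=(\varphi,\Phi)$. $C$ is strongly measurable if for all $(t_{0},x,v)\in\mathbb{R}_{+}\times Y$ the mapping $s\mapsto\Vert\Phi(s,t_{0},x)v\Vert$ is measurable on $[t_{0},\infty)$. $C$ has uniform exponential growth if there exist constants $M\geq 1$, $\omega>0$ with $\Vert\Phi(t,t_{0},x)v\Vert\leq Me^{\omega(t-s)}\Vert\Phi(s,t_{0},x)v\Vert$ for all $(t,s),(s,t_{0})\in T$ and all $(x,v)\in Y$. $C$ is uniformly exponentially stable if there exist constants $N\geq 1$, $\nu>0$ with $\Vert\Phi(t,t_{0},x)v\Vert\leq Ne^{-\nu(t-s)}\Vert\Phi(s,t_{0},x)v\Vert$ for all $(t,s),(s,t_{0})\in T$ and all $(x,v)\in Y$. *)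

theory Defs
  imports "HOL-Analysis.Analysis"
begin

text \<open>Time arguments range over the type of real numbers, but every condition is imposed
  only on nonnegative times \<open>t \<ge> t\<^sub>0 \<ge> 0\<close>; values elsewhere are irrelevant.\<close>

definition time_pairs :: "(real \<times> real) set" where
  "time_pairs = {(t, t0). 0 \<le> t0 \<and> t0 \<le> t}"

text \<open>The class \<open>\<R>\<close>; a member is a function on \<open>[0, \<infinity>)\<close>, with arbitrary values
  at negative arguments.\<close>

definition rate_functions :: "(real \<Rightarrow> real) set" where
  "rate_functions =
    {R. R ` {0..} \<subseteq> {0..} \<and> mono_on {0..} R \<and> R 0 = 0 \<and> (\<forall>t>0. R t > 0)}"

definition evolution_semiflow ::
    "(real \<Rightarrow> real \<Rightarrow> 'x::metric_space \<Rightarrow> 'x) \<Rightarrow> bool" where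
  "evolution_semiflow \<phi> \<longleftrightarrow>
     (\<forall>t\<ge>0. \<forall>x. \<phi> t t x = x) \<and>
     (\<forall>t s t0 x. (t, s) \<in> time_pairs \<longrightarrow> (s, t0) \<in> time_pairs \<longrightarrow>
        \<phi> t s (\<phi> s t0 x) = \<phi> t t0 x)"

definition evolution_cocycle ::
    "(real \<Rightarrow> real \<Rightarrow> 'x::metric_space \<Rightarrow> 'x) \<Rightarrow>
     (real \<Rightarrow> real \<Rightarrow> 'x \<Rightarrow> 'v::banach \<Rightarrow>\<^sub>L 'v) \<Rightarrow> bool" where
  "evolution_cocycle \<phi> \<Phi> \<longleftrightarrow>
     (\<forall>t\<ge>0. \<forall>x. \<Phi> t t x = id_blinfun) \<and>
     (\<forall>t s t0 x. (t, s) \<in> time_pairs \<longrightarrow> (s, t0) \<in> time_pairs \<longrightarrow>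
        \<Phi> t s (\<phi> s t0 x) o\<^sub>L \<Phi> s t0 x = \<Phi> t t0 x)"

text \<open>\<open>C = (\<phi>, \<Phi>)\<close> as a mapping on \<open>Y = X \<times> V\<close>. The properties of \<open>C\<close> below constrain only
  its cocycle component, so they are stated as predicates of \<open>\<Phi>\<close>.\<close>

definition skew_evolution_semiflow ::
    "(real \<Rightarrow> real \<Rightarrow> 'x \<times> 'v \<Rightarrow> 'x \<times> 'v) \<Rightarrow>
     (real \<Rightarrow> real \<Rightarrow> 'x::metric_space \<Rightarrow> 'x) \<Rightarrow>
     (real \<Rightarrow> real \<Rightarrow> 'x \<Rightarrow> 'v::banach \<Rightarrow>\<^sub>L 'v) \<Rightarrow> bool" where
  "skew_evolution_semiflow C \<phi> \<Phi> \<longleftrightarrow>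
     evolution_semiflow \<phi> \<and> evolution_cocycle \<phi> \<Phi> \<and>
     (\<forall>t s x v. (t, s) \<in> time_pairs \<longrightarrow>
        C t s (x, v) = (\<phi> t s x, blinfun_apply (\<Phi> t s x) v))"

text \<open>Measurability is meant in the sense of Lebesgue.\<close>

definition strongly_measurable ::
    "(real \<Rightarrow> real \<Rightarrow> 'x::metric_space \<Rightarrow> 'v::banach \<Rightarrow>\<^sub>L 'v) \<Rightarrow> bool" where
  "strongly_measurable \<Phi> \<longleftrightarrow>
     (\<forall>t0\<ge>0. \<forall>x v.
        (\<lambda>s. norm (blinfun_apply (\<Phi> s t0 x) v)) \<in> borel_measurable (lebesgue_on {t0..}))"

definition uniform_exponential_growth ::
    "(real \<Rightarrow> real \<Rightarrow> 'x::metric_space \<Rightarrow> 'v::banach \<Rightarrow>\<^sub>L 'v) \<Rightarrow> bool" where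
  "uniform_exponential_growth \<Phi> \<longleftrightarrow>
     (\<exists>M \<omega>. M \<ge> 1 \<and> \<omega> > 0 \<and>
       (\<forall>t s t0 x v. (t, s) \<in> time_pairs \<longrightarrow> (s, t0) \<in> time_pairs \<longrightarrow>
          norm (blinfun_apply (\<Phi> t t0 x) v)
            \<le> M * exp (\<omega> * (t - s)) * norm (blinfun_apply (\<Phi> s t0 x) v)))"

definition uniformly_exponentially_stable ::
    "(real \<Rightarrow> real \<Rightarrow> 'x::metric_space \<Rightarrow> 'v::banach \<Rightarrow>\<^sub>L 'v) \<Rightarrow> bool" where
  "uniformly_exponentially_stable \<Phi> \<longleftrightarrow>
     (\<exists>N \<nu>. N \<ge> 1 \<and> \<nu> > 0 \<and>
       (\<forall>t s t0 x v. (t, s) \<in> time_pairs \<longrightarrow> (s, t0) \<in> time_pairs \<longrightarrow>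
          norm (blinfun_apply (\<Phi> t t0 x) v)
            \<le> N * exp (- \<nu> * (t - s)) * norm (blinfun_apply (\<Phi> s t0 x) v)))"

end

theory Submission
  imports Defs
begin

text \<open>The implication from (iii) to (i) is the only substantial one; the idea is to convert
  the integral bound into a \<^emph>\<open>uniform half-life\<close>: a span of time over which every trajectory
  loses at least half of its norm, whatever its initial time, base point and vector. Iterating
  a half-life and filling the gaps between its multiples with the exponential growth bound
  gives exponential stability.

  For the half-life, write \<open>f s\<close> for the norm of a trajectory that starts at time \<open>t\<^sub>0\<close> with
  \<open>f t\<^sub>0 = 1\<close>, and let \<open>K = M e\<^sup>\<omega>\<close> bound the growth over one unit of time. Since \<open>R\<close> composed with
  \<open>f\<close> has integral at most \<open>N R 1\<close>, it must take a value at most \<open>\<eta> = N R 1 / T\<close> at some time \<open>s\<close>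
  of the interval \<open>[t\<^sub>0, t\<^sub>0 + T]\<close>. Knowing that \<open>R (f s)\<close> is small is useless by itself, because
  the trajectory may grow again; but it can be restarted at \<open>s\<close>, and the integral bound for
  the restarted trajectory controls \<open>R (f t / K)\<close> by \<open>N R (f s)\<close> for all \<open>t \<ge> s + 1\<close>
  (\<open>delayed_rate_bound\<close>). Hence \<open>R (f t / K) \<le> N \<eta>\<close> at \<open>t = t\<^sub>0 + T + 1\<close>. As soon as \<open>T\<close> is so
  large that \<open>N \<eta> < R (1 / (2 K))\<close>, which is possible since \<open>R\<close> is positive off zero,
  monotonicity of \<open>R\<close> forces \<open>f t < 1/2\<close> (\<open>half_life_exists\<close>). The choice of \<open>T\<close> involves only
  \<open>R\<close>, \<open>N\<close> and \<open>K\<close>, and linearity of the cocycle removes the normalisation \<open>f t\<^sub>0 = 1\<close>. Working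
  at the fixed scale \<open>f t\<^sub>0 = 1\<close> matters because a function in \<open>\<R>\<close> may behave quite
  differently at different scales.

  Conversely, for an exponentially stable cocycle the identity serves as \<open>R\<close>, and (iii) is
  the case \<open>t = t\<^sub>0\<close> of (ii).\<close>

lemma cocycle_initial:
  assumes "evolution_cocycle \<phi> \<Phi>" "0 \<le> t0"
  shows "blinfun_apply (\<Phi> t0 t0 x) v = v"
  using assms by (simp add: evolution_cocycle_def)

lemma cocycle_restart:
  assumes "evolution_cocycle \<phi> \<Phi>" "0 \<le> t0" "t0 \<le> s" "s \<le> t"
  shows "blinfun_apply (\<Phi> t t0 x) v =
    blinfun_apply (\<Phi> t s (\<phi> s t0 x)) (blinfun_apply (\<Phi> s t0 x) v)"
proof -
  have "\<Phi> t s (\<phi> s t0 x) o\<^sub>L \<Phi> s t0 x = \<Phi> t t0 x"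
    using assms by (auto simp: evolution_cocycle_def time_pairs_def)
  then show ?thesis
    by (metis blinfun_apply_blinfun_compose)
qed

text \<open>The step function with value \<open>c\<close> on \<open>[a, b]\<close> lies below the integrand. This is the form in
  which pointwise information along a trajectory enters its integral.\<close>

lemma const_times_length_le_nn_integral:
  fixes g :: "real \<Rightarrow> ennreal"
  assumes "a \<le> b" "{a..b} \<subseteq> S" "\<And>s. s \<in> {a..b} \<Longrightarrow> c \<le> g s"
  shows "c * ennreal (b - a) \<le> (\<integral>\<^sup>+ s\<in>S. g s \<partial>lebesgue)"
proof -
  have "c * ennreal (b - a) = (\<integral>\<^sup>+ s. c * indicator {a..b} s \<partial>lebesgue)"
    using assms(1) by (subst nn_integral_cmult_indicator) auto
  also have "\<dots> \<le> (\<integral>\<^sup>+ s\<in>S. g s \<partial>lebesgue)"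
    using assms(2,3) by (intro nn_integral_mono) (auto simp: indicator_def)
  finally show ?thesis .
qed

lemma nn_integral_exp_decay:
  fixes \<nu> :: real
  assumes "\<nu> > 0"
  shows "(\<integral>\<^sup>+ s\<in>{t..}. ennreal (exp (- \<nu> * (s - t))) \<partial>lebesgue) = ennreal (1 / \<nu>)"
proof -
  let ?F = "\<lambda>s. - exp (- \<nu> * (s - t)) / \<nu>"
  have "filterlim (\<lambda>s. \<nu> * (- t + s)) at_top at_top"
    by (intro filterlim_tendsto_pos_mult_at_top[OF tendsto_const assms]
          filterlim_tendsto_add_at_top[OF tendsto_const] filterlim_ident)
  then have "filterlim (\<lambda>s. - \<nu> * (s - t)) at_bot at_top"
    by (simp add: filterlim_uminus_at_bot algebra_simps)
  then have "((\<lambda>s. exp (- \<nu> * (s - t))) \<longlongrightarrow> 0) at_top"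
    by (rule filterlim_compose[OF exp_at_bot])
  then have lim: "(?F \<longlongrightarrow> 0) at_top"
    using tendsto_divide[OF tendsto_minus tendsto_const, of _ 0 at_top \<nu>] assms by simp
  have "(\<integral>\<^sup>+ s. ennreal (exp (- \<nu> * (s - t))) * indicator {t..} s \<partial>lborel) = 0 - ?F t"
    by (rule nn_integral_FTC_atLeast[OF _ _ _ lim])
       (use assms in \<open>auto intro!: derivative_eq_intros\<close>)
  then show ?thesis
    by (simp add: nn_integral_completion)
qed

section \<open>Stability implies the integral bounds\<close>

lemma stable_imp_integral_bound:
  assumes "uniformly_exponentially_stable \<Phi>"
  shows "\<exists>R\<in>rate_functions. \<exists>N::real. N \<ge> 1 \<and>
    (\<forall>t t0 x v. (t, t0) \<in> time_pairs \<longrightarrow>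
      (\<integral>\<^sup>+ s\<in>{t..}. ennreal (R (norm (blinfun_apply (\<Phi> s t0 x) v))) \<partial>lebesgue)
        \<le> ennreal (N * R (norm (blinfun_apply (\<Phi> t t0 x) v))))"
proof -
  obtain N \<nu> where "N \<ge> 1" "\<nu> > 0"
    and decay: "\<And>t s t0 x v. (t, s) \<in> time_pairs \<Longrightarrow> (s, t0) \<in> time_pairs \<Longrightarrow>
      norm (blinfun_apply (\<Phi> t t0 x) v)
        \<le> N * exp (- \<nu> * (t - s)) * norm (blinfun_apply (\<Phi> s t0 x) v)"
    using assms unfolding uniformly_exponentially_stable_def by blast
  let ?N = "max 1 (N / \<nu>)"
  have "(\<integral>\<^sup>+ s\<in>{t..}. ennreal (norm (blinfun_apply (\<Phi> s t0 x) v)) \<partial>lebesgue)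
      \<le> ennreal (?N * norm (blinfun_apply (\<Phi> t t0 x) v))" (is "?I \<le> _")
    if "(t, t0) \<in> time_pairs" for t t0 x v
  proof -
    let ?a = "norm (blinfun_apply (\<Phi> t t0 x) v)"
    have "?I \<le> (\<integral>\<^sup>+ s. ennreal (N * ?a) * (ennreal (exp (- \<nu> * (s - t))) * indicator {t..} s)
        \<partial>lebesgue)"
    proof (intro nn_integral_mono)
      fix s
      show "ennreal (norm (blinfun_apply (\<Phi> s t0 x) v)) * indicator {t..} s
          \<le> ennreal (N * ?a) * (ennreal (exp (- \<nu> * (s - t))) * indicator {t..} s)"
      proof (cases "t \<le> s")
        case True
        then have "norm (blinfun_apply (\<Phi> s t0 x) v) \<le> N * ?a * exp (- \<nu> * (s - t))"
          using decay[of s t t0 x v] that by (simp add: time_pairs_def mult_ac)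
        then show ?thesis
          using True \<open>N \<ge> 1\<close> by (simp add: ennreal_mult[symmetric] ennreal_leI)
      qed simp
    qed
    also have "\<dots> = ennreal (N * ?a) *
        (\<integral>\<^sup>+ s\<in>{t..}. ennreal (exp (- \<nu> * (s - t))) \<partial>lebesgue)"
      by (intro nn_integral_cmult) (auto intro!: measurable_completion)
    also have "\<dots> = ennreal (N / \<nu> * ?a)"
      using \<open>N \<ge> 1\<close> \<open>\<nu> > 0\<close>
      by (subst nn_integral_exp_decay) (auto simp: ennreal_mult[symmetric])
    also have "\<dots> \<le> ennreal (?N * ?a)"
      by (intro ennreal_leI mult_right_mono) auto
    finally show ?thesis .
  qed
  moreover have "(\<lambda>u. u) \<in> rate_functions"
    by (auto simp: rate_functions_def mono_on_def)
  ultimately show ?thesis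
    by (intro bexI[of _ "\<lambda>u. u"] exI[of _ ?N]) auto
qed

section \<open>An integral bound yields a uniform half-life\<close>

text \<open>Over a unit of time a trajectory grows at most by the factor \<open>M e\<^sup>\<omega>\<close>, so a large value
  at time \<open>t\<close> forces comparably large values on the whole interval \<open>[t - 1, t]\<close>; these
  contribute to the integral, which the hypothesis bounds.\<close>

lemma delayed_rate_bound:
  assumes R: "R \<in> rate_functions" and "1 \<le> M" "0 < \<omega>" "1 \<le> N"
    and growth: "\<And>t s t0 x v. 0 \<le> t0 \<Longrightarrow> t0 \<le> s \<Longrightarrow> s \<le> t \<Longrightarrow>
      norm (blinfun_apply (\<Phi> t t0 x) v)
        \<le> M * exp (\<omega> * (t - s)) * norm (blinfun_apply (\<Phi> s t0 x) v)"
    and integral_bound: "\<And>t0 x v. 0 \<le> t0 \<Longrightarrow>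
      (\<integral>\<^sup>+ s\<in>{t0..}. ennreal (R (norm (blinfun_apply (\<Phi> s t0 x) v))) \<partial>lebesgue)
        \<le> ennreal (N * R (norm v))"
    and "0 \<le> t0" "t0 + 1 \<le> t"
  shows "R (norm (blinfun_apply (\<Phi> t t0 x) v) / (M * exp \<omega>)) \<le> N * R (norm v)"
proof -
  let ?f = "\<lambda>s. norm (blinfun_apply (\<Phi> s t0 x) v)"
  have R_nonneg: "0 \<le> R u" if "0 \<le> u" for u
    using R that by (auto simp: rate_functions_def)
  have below: "R (?f t / (M * exp \<omega>)) \<le> R (?f s)" if "s \<in> {t - 1..t}" for s
  proof -
    have "?f t \<le> M * exp (\<omega> * (t - s)) * ?f s"
      using that assms by (intro growth) auto
    also have "\<dots> \<le> M * exp \<omega> * ?f s"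
      using that \<open>1 \<le> M\<close> \<open>0 < \<omega>\<close>
      by (intro mult_right_mono mult_left_mono) (auto simp: mult_left_le)
    finally have "?f t / (M * exp \<omega>) \<le> ?f s"
      using \<open>1 \<le> M\<close> by (simp add: divide_le_eq mult_ac)
    then show ?thesis
      using R \<open>1 \<le> M\<close> by (auto simp: rate_functions_def mono_on_def)
  qed
  have "ennreal (R (?f t / (M * exp \<omega>))) * ennreal (t - (t - 1))
      \<le> (\<integral>\<^sup>+ s\<in>{t0..}. ennreal (R (?f s)) \<partial>lebesgue)"
    using below assms by (intro const_times_length_le_nn_integral) (auto intro!: ennreal_leI)
  also have "\<dots> \<le> ennreal (N * R (norm v))"
    using \<open>0 \<le> t0\<close> by (rule integral_bound)
  finally show ?thesis
    using R_nonneg[of "norm v"] \<open>1 \<le> N\<close> by (simp add: ennreal_le_iff)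
qed

text \<open>A value of \<open>R\<close> along the trajectory that is small somewhere in \<open>[t\<^sub>0, t\<^sub>0 + T]\<close> is found by
  averaging and kept under control until \<open>t\<^sub>0 + T + 1\<close> by restarting the trajectory there.\<close>

lemma half_life_exists:
  fixes \<Phi> :: "real \<Rightarrow> real \<Rightarrow> 'x::metric_space \<Rightarrow> 'v::banach \<Rightarrow>\<^sub>L 'v"
  assumes cocycle: "evolution_cocycle \<phi> \<Phi>"
    and R: "R \<in> rate_functions" and "1 \<le> M" "0 < \<omega>" "1 \<le> N"
    and growth: "\<And>t s t0 x v. 0 \<le> t0 \<Longrightarrow> t0 \<le> s \<Longrightarrow> s \<le> t \<Longrightarrow>
      norm (blinfun_apply (\<Phi> t t0 x) v)
        \<le> M * exp (\<omega> * (t - s)) * norm (blinfun_apply (\<Phi> s t0 x) v)"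
    and integral_bound: "\<And>t0 x v. 0 \<le> t0 \<Longrightarrow>
      (\<integral>\<^sup>+ s\<in>{t0..}. ennreal (R (norm (blinfun_apply (\<Phi> s t0 x) v))) \<partial>lebesgue)
        \<le> ennreal (N * R (norm v))"
  shows "\<exists>T>0. \<forall>t0\<ge>0. \<forall>x v. norm (blinfun_apply (\<Phi> (t0 + T) t0 x) v) \<le> norm v / 2"
proof -
  define K where "K = M * exp \<omega>"
  have "K > 0"
    using \<open>1 \<le> M\<close> by (simp add: K_def)
  have R_nonneg: "0 \<le> R u" if "0 \<le> u" for u
    using R that by (auto simp: rate_functions_def)
  have R_pos: "0 < R u" if "0 < u" for u
    using R that by (auto simp: rate_functions_def)
  have R_mono: "R u \<le> R w" if "0 \<le> u" "u \<le> w" for u w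
    using R that by (auto simp: rate_functions_def mono_on_def)
  define \<epsilon> where "\<epsilon> = R (1 / (2 * K))"
  have "\<epsilon> > 0"
    using \<open>K > 0\<close> by (auto simp: \<epsilon>_def intro!: R_pos)
  \<comment> \<open>The factor 2 turns the bound \<open>N (N R 1 / T)\<close> on the rate into one strictly below \<open>\<epsilon>\<close>.\<close>
  define T where "T = 2 * N * N * R 1 / \<epsilon>"
  have "T > 0"
    using \<open>\<epsilon> > 0\<close> \<open>1 \<le> N\<close> R_pos[of 1] by (simp add: T_def)
  have unit: "norm (blinfun_apply (\<Phi> (t0 + (T + 1)) t0 x) v) \<le> 1 / 2"
    if "0 \<le> t0" and v: "norm v = 1" for t0 x v
  proof -
    let ?f = "\<lambda>s. norm (blinfun_apply (\<Phi> s t0 x) v)"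
    have "\<exists>s\<in>{t0..t0 + T}. R (?f s) < \<epsilon> / N"
    proof (rule ccontr)
      assume "\<not> ?thesis"
      then have "\<epsilon> / N \<le> R (?f s)" if "s \<in> {t0..t0 + T}" for s
        using that by force
      then have "ennreal (\<epsilon> / N) * ennreal (t0 + T - t0)
          \<le> (\<integral>\<^sup>+ s\<in>{t0..}. ennreal (R (?f s)) \<partial>lebesgue)"
        using \<open>T > 0\<close>
        by (intro const_times_length_le_nn_integral) (auto intro!: ennreal_leI)
      also have "\<dots> \<le> ennreal (N * R 1)"
        using integral_bound[OF \<open>0 \<le> t0\<close>, of x v] v by simp
      finally have "\<epsilon> / N * T \<le> N * R 1"
        using \<open>\<epsilon> > 0\<close> \<open>1 \<le> N\<close> \<open>T > 0\<close> R_pos[of 1]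
        by (simp add: ennreal_mult[symmetric] ennreal_le_iff)
      moreover have "\<epsilon> / N * T = 2 * (N * R 1)"
        using \<open>\<epsilon> > 0\<close> \<open>1 \<le> N\<close> by (simp add: T_def)
      moreover have "0 < N * R 1"
        using \<open>1 \<le> N\<close> R_pos[of 1] by simp
      ultimately show False
        by linarith
    qed
    then obtain s where s: "s \<in> {t0..t0 + T}" "R (?f s) < \<epsilon> / N"
      by blast
    let ?t = "t0 + (T + 1)"
    have "?f ?t = norm (blinfun_apply (\<Phi> ?t s (\<phi> s t0 x)) (blinfun_apply (\<Phi> s t0 x) v))"
      using s \<open>0 \<le> t0\<close> by (subst cocycle_restart[OF cocycle, of t0 s]) auto
    also have "R (\<dots> / K) \<le> N * R (?f s)"
      unfolding K_def using s \<open>0 \<le> t0\<close>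
      by (intro delayed_rate_bound[OF R \<open>1 \<le> M\<close> \<open>0 < \<omega>\<close> \<open>1 \<le> N\<close> growth integral_bound]) auto
    also have "\<dots> < \<epsilon>"
      using s(2) \<open>1 \<le> N\<close> by (simp add: field_simps)
    finally have "R (?f ?t / K) < R (1 / (2 * K))"
      by (simp add: \<epsilon>_def)
    then have "?f ?t / K < 1 / (2 * K)"
      using R_mono[of "1 / (2 * K)" "?f ?t / K"] \<open>K > 0\<close> by force
    then show ?thesis
      using \<open>K > 0\<close> by (simp add: field_simps)
  qed
  have "norm (blinfun_apply (\<Phi> (t0 + (T + 1)) t0 x) v) \<le> norm v / 2" if "0 \<le> t0" for t0 x v
  proof (cases "v = 0")
    case False
    then have "norm (blinfun_apply (\<Phi> (t0 + (T + 1)) t0 x) (v /\<^sub>R norm v)) \<le> 1 / 2"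
      using that by (intro unit) auto
    then show ?thesis
      using False by (simp add: blinfun.scaleR_right field_simps)
  qed simp
  then show ?thesis
    using \<open>T > 0\<close> by (intro exI[of _ "T + 1"]) auto
qed

section \<open>A uniform half-life yields exponential stability\<close>

lemma half_life_iterate:
  assumes cocycle: "evolution_cocycle \<phi> \<Phi>" and "0 < T" "0 \<le> t0"
    and half: "\<And>t0 x v. 0 \<le> t0 \<Longrightarrow> norm (blinfun_apply (\<Phi> (t0 + T) t0 x) v) \<le> norm v / 2"
  shows "norm (blinfun_apply (\<Phi> (t0 + real n * T) t0 x) v) \<le> norm v / 2 ^ n"
proof (induction n)
  case 0
  then show ?case
    using cocycle_initial[OF cocycle \<open>0 \<le> t0\<close>] by simp
next
  case (Suc n)
  let ?s = "t0 + real n * T"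
  have "t0 \<le> ?s" "?s \<le> ?s + T"
    using \<open>0 < T\<close> by auto
  then have "norm (blinfun_apply (\<Phi> (?s + T) t0 x) v)
      = norm (blinfun_apply (\<Phi> (?s + T) ?s (\<phi> ?s t0 x)) (blinfun_apply (\<Phi> ?s t0 x) v))"
    using \<open>0 \<le> t0\<close> by (subst cocycle_restart[OF cocycle, of t0 ?s]) auto
  also have "\<dots> \<le> norm (blinfun_apply (\<Phi> ?s t0 x) v) / 2"
    using \<open>0 \<le> t0\<close> \<open>t0 \<le> ?s\<close> by (intro half) auto
  also have "\<dots> \<le> norm v / 2 ^ Suc n"
    using Suc by simp
  finally show ?case
    by (simp add: algebra_simps)
qed

lemma half_life_imp_stable:
  fixes \<Phi> :: "real \<Rightarrow> real \<Rightarrow> 'x::metric_space \<Rightarrow> 'v::banach \<Rightarrow>\<^sub>L 'v"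
  assumes cocycle: "evolution_cocycle \<phi> \<Phi>" and "1 \<le> M" "0 < \<omega>" "0 < T"
    and growth: "\<And>t s t0 x v. 0 \<le> t0 \<Longrightarrow> t0 \<le> s \<Longrightarrow> s \<le> t \<Longrightarrow>
      norm (blinfun_apply (\<Phi> t t0 x) v)
        \<le> M * exp (\<omega> * (t - s)) * norm (blinfun_apply (\<Phi> s t0 x) v)"
    and half: "\<And>t0 x v. 0 \<le> t0 \<Longrightarrow> norm (blinfun_apply (\<Phi> (t0 + T) t0 x) v) \<le> norm v / 2"
  shows "uniformly_exponentially_stable \<Phi>"
proof -
  define \<nu> where "\<nu> = ln 2 / T"
  \<comment> \<open>During the incomplete last half-life the norm may grow by \<open>M exp (\<omega> T)\<close>; the factor 2 makes
    up for the halving that it does not achieve.\<close>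
  define N where "N = 2 * M * exp (\<omega> * T)"
  have from_start: "norm (blinfun_apply (\<Phi> t t0 x) v) \<le> N * exp (- \<nu> * (t - t0)) * norm v"
    if "0 \<le> t0" "t0 \<le> t" for t t0 x v
  proof -
    define n where "n = nat \<lfloor>(t - t0) / T\<rfloor>"
    have "0 \<le> (t - t0) / T"
      using that \<open>0 < T\<close> by simp
    then have "real n \<le> (t - t0) / T" "(t - t0) / T < real n + 1"
      unfolding n_def by linarith+
    then have n: "real n * T \<le> t - t0" "t - t0 < (real n + 1) * T"
      using \<open>0 < T\<close> by (simp_all add: field_simps)
    let ?s = "t0 + real n * T"
    have "t0 \<le> ?s" "t - ?s \<le> T"
      using \<open>0 < T\<close> n by (simp_all add: algebra_simps)
    have "\<nu> * (t - t0) \<le> \<nu> * ((real n + 1) * T)"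
      using n \<open>0 < T\<close> by (intro mult_left_mono) (auto simp: \<nu>_def)
    also have "\<dots> = (real n + 1) * ln 2"
      using \<open>0 < T\<close> by (simp add: \<nu>_def)
    finally have "exp (- (real n + 1) * ln 2) \<le> exp (- \<nu> * (t - t0))"
      by (simp add: algebra_simps)
    moreover have "exp (- (real n + 1) * ln 2) = 1 / (2 * 2 ^ n)"
      by (simp add: exp_minus exp_add exp_of_nat_mult algebra_simps exp_diff inverse_eq_divide)
    moreover have "1 / 2 ^ n = 2 * (1 / (2 * 2 ^ n) :: real)"
      by simp
    ultimately have pow: "1 / 2 ^ n \<le> 2 * exp (- \<nu> * (t - t0))"
      by linarith
    have "norm (blinfun_apply (\<Phi> t t0 x) v)
        \<le> M * exp (\<omega> * (t - ?s)) * norm (blinfun_apply (\<Phi> ?s t0 x) v)"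
      using that \<open>t0 \<le> ?s\<close> n by (intro growth) auto
    also have "\<dots> \<le> M * exp (\<omega> * T) * (norm v / 2 ^ n)"
      using \<open>t - ?s \<le> T\<close> \<open>1 \<le> M\<close> \<open>0 < \<omega>\<close>
        half_life_iterate[OF cocycle \<open>0 < T\<close> \<open>0 \<le> t0\<close> half]
      by (intro mult_mono mult_left_mono) simp_all
    also have "\<dots> = M * exp (\<omega> * T) * norm v * (1 / 2 ^ n)"
      by simp
    also have "\<dots> \<le> M * exp (\<omega> * T) * norm v * (2 * exp (- \<nu> * (t - t0)))"
      using \<open>1 \<le> M\<close> by (intro mult_left_mono pow) auto
    finally show ?thesis
      by (simp add: N_def mult_ac)
  qed
  have "norm (blinfun_apply (\<Phi> t t0 x) v)
      \<le> N * exp (- \<nu> * (t - s)) * norm (blinfun_apply (\<Phi> s t0 x) v)"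
    if "(t, s) \<in> time_pairs" "(s, t0) \<in> time_pairs" for t s t0 x v
    using from_start[of s t "\<phi> s t0 x" "blinfun_apply (\<Phi> s t0 x) v"] that
      cocycle_restart[OF cocycle, of t0 s t x v]
    by (auto simp: time_pairs_def)
  moreover have "1 * 1 \<le> M * exp (\<omega> * T)"
    using \<open>1 \<le> M\<close> \<open>0 < \<omega>\<close> \<open>0 < T\<close> by (intro mult_mono) auto
  then have "N \<ge> 1"
    by (simp add: N_def)
  moreover have "\<nu> > 0"
    using \<open>0 < T\<close> by (simp add: \<nu>_def)
  ultimately show ?thesis
    unfolding uniformly_exponentially_stable_def by blast
qed

section \<open>The characterisation of stability\<close>

theorem theorem3p1:
  fixes C :: "real \<Rightarrow> real \<Rightarrow> 'x::metric_space \<times> 'v::banach \<Rightarrow> 'x \<times> 'v"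
    and \<phi> :: "real \<Rightarrow> real \<Rightarrow> 'x \<Rightarrow> 'x"
    and \<Phi> :: "real \<Rightarrow> real \<Rightarrow> 'x \<Rightarrow> 'v \<Rightarrow>\<^sub>L 'v"
  assumes "skew_evolution_semiflow C \<phi> \<Phi>"
    and "strongly_measurable \<Phi>"
    and "uniform_exponential_growth \<Phi>"
  shows "(uniformly_exponentially_stable \<Phi> \<longleftrightarrow>
           (\<exists>R\<in>rate_functions. \<exists>N::real. N \<ge> 1 \<and>
             (\<forall>t t0 x v. (t, t0) \<in> time_pairs \<longrightarrow>
               (\<integral>\<^sup>+ s\<in>{t..}. ennreal (R (norm (blinfun_apply (\<Phi> s t0 x) v))) \<partial>lebesgue)
                 \<le> ennreal (N * R (norm (blinfun_apply (\<Phi> t t0 x) v))))))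
       \<and> (uniformly_exponentially_stable \<Phi> \<longleftrightarrow>
           (\<exists>R\<in>rate_functions. \<exists>N::real. N \<ge> 1 \<and>
             (\<forall>t0 x v. 0 \<le> t0 \<longrightarrow>
               (\<integral>\<^sup>+ s\<in>{t0..}. ennreal (R (norm (blinfun_apply (\<Phi> s t0 x) v))) \<partial>lebesgue)
                 \<le> ennreal (N * R (norm v)))))"
proof -
  let ?ii = "\<exists>R\<in>rate_functions. \<exists>N::real. N \<ge> 1 \<and>
    (\<forall>t t0 x v. (t, t0) \<in> time_pairs \<longrightarrow>
      (\<integral>\<^sup>+ s\<in>{t..}. ennreal (R (norm (blinfun_apply (\<Phi> s t0 x) v))) \<partial>lebesgue)
        \<le> ennreal (N * R (norm (blinfun_apply (\<Phi> t t0 x) v))))"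
  let ?iii = "\<exists>R\<in>rate_functions. \<exists>N::real. N \<ge> 1 \<and>
    (\<forall>t0 x v. 0 \<le> t0 \<longrightarrow>
      (\<integral>\<^sup>+ s\<in>{t0..}. ennreal (R (norm (blinfun_apply (\<Phi> s t0 x) v))) \<partial>lebesgue)
        \<le> ennreal (N * R (norm v)))"
  have cocycle: "evolution_cocycle \<phi> \<Phi>"
    using assms(1) by (simp add: skew_evolution_semiflow_def)
  have "uniformly_exponentially_stable \<Phi> \<Longrightarrow> ?ii"
    by (rule stable_imp_integral_bound)
  moreover have "?iii" if ii: ?ii
  proof -
    obtain R N where "R \<in> rate_functions" "N \<ge> 1"
      and bound: "\<And>t t0 x v. (t, t0) \<in> time_pairs \<Longrightarrow>
        (\<integral>\<^sup>+ s\<in>{t..}. ennreal (R (norm (blinfun_apply (\<Phi> s t0 x) v))) \<partial>lebesgue)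
          \<le> ennreal (N * R (norm (blinfun_apply (\<Phi> t t0 x) v)))"
      using ii by blast
    moreover have "(\<integral>\<^sup>+ s\<in>{t0..}. ennreal (R (norm (blinfun_apply (\<Phi> s t0 x) v))) \<partial>lebesgue)
        \<le> ennreal (N * R (norm v))" if "0 \<le> t0" for t0 x v
      using bound[of t0 t0 x v] that cocycle_initial[OF cocycle that, of x v]
      by (simp add: time_pairs_def)
    ultimately show ?thesis
      by blast
  qed
  moreover have "uniformly_exponentially_stable \<Phi>" if iii: ?iii
  proof -
    obtain R N where R: "R \<in> rate_functions" "1 \<le> N"
      and bound: "\<And>t0 x v. 0 \<le> t0 \<Longrightarrow>
        (\<integral>\<^sup>+ s\<in>{t0..}. ennreal (R (norm (blinfun_apply (\<Phi> s t0 x) v))) \<partial>lebesgue)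
          \<le> ennreal (N * R (norm v))"
      using iii by blast
    obtain M \<omega> where M: "1 \<le> M" "0 < \<omega>"
      and growth: "\<And>t s t0 x v. 0 \<le> t0 \<Longrightarrow> t0 \<le> s \<Longrightarrow> s \<le> t \<Longrightarrow>
        norm (blinfun_apply (\<Phi> t t0 x) v)
          \<le> M * exp (\<omega> * (t - s)) * norm (blinfun_apply (\<Phi> s t0 x) v)"
      using assms(3) unfolding uniform_exponential_growth_def time_pairs_def by fastforce
    obtain T where "0 < T" and half: "\<And>t0 x v. 0 \<le> t0 \<Longrightarrow>
        norm (blinfun_apply (\<Phi> (t0 + T) t0 x) v) \<le> norm v / 2"
      using half_life_exists[OF cocycle R(1) M R(2) growth bound] by blast
    then show ?thesis
      using half_life_imp_stable[OF cocycle M _ growth half] by blast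
  qed
  ultimately show ?thesis
    by blast
qed

end
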